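(* For every positive integer $m$, put $\alpha_m:=\mu_m-\mu_{m^+}$. Then $$\alpha_m=\frac{\chi(m)}{m}\prod_{p\le\sigma(m)+1}\left(1-\frac1p\right),$$ and for all real $x\ge 1$ and all integers $m\ge 1$, $$\#\{n\le x: g(n)=m\}=x\,\alpha_m+O(2^m),$$ where the implied constant is absolute.
   Context: A positive integer $n$ is called practical if every integer between $1$ and $n$ can be written as a sum of distinct positive divisors of $n$. $\chi$ is the characteristic function of the set of practical numbers, and $\sigma(n)$ is the sum of the positive divisors of $n$. Products over $p$ run over primes; $n$ ranges over positive integers. For a positive integer $n$, $g(n)$ denotes the practical component of $n$, i.e. the largest divisor of $n$ which is practical. For real $y$, $$\mu_y:=1-\sum_{n<y}\frac{\chi(n)}{n}\prod_{p\le \sigma(n)+1}\left(1-\frac1p\right),$$ and $\mu_{m^+}:=\lim_{y\to m^+}\mu_y$ denotes the right-hand limit at $m$. *)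

theory Defs
  imports Complex_Main
    "HOL-Computational_Algebra.Primes"
    "HOL-Library.Indicator_Function"
begin

definition practical :: "nat \<Rightarrow> bool" where
  "practical n \<longleftrightarrow> n > 0 \<and> (\<forall>k\<in>{1..n}. \<exists>D. D \<subseteq> {d. d dvd n} \<and> k = \<Sum>D)"

definition practical_chi :: "nat \<Rightarrow> real" where
  "practical_chi = indicator {n. practical n}"

definition divisor_sum :: "nat \<Rightarrow> nat" where
  "divisor_sum n = \<Sum>{d. d dvd n}"

(* For n = 0 the set of practical divisors is infinite and the value is unspecified;
   only arguments n > 0 are meaningful. *)
definition practical_component :: "nat \<Rightarrow> nat" where
  "practical_component n = Max {d. d dvd n \<and> practical d}"

definition practical_mu :: "real \<Rightarrow> real" where
  "practical_mu y = 1 - (\<Sum>n | n > 0 \<and> real n < y.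
     practical_chi n / real n * (\<Prod>p | prime p \<and> p \<le> divisor_sum n + 1. 1 - 1 / real p))"

definition practical_alpha :: "nat \<Rightarrow> real" where
  "practical_alpha m = practical_mu (real m) - Lim (at_right (real m)) practical_mu"

end

theory Submission
  imports Defs
begin

text \<open>
  A practical number $m$ is the practical component of $n$ exactly when $m \mid n$ and $n/m$ has no
  prime factor $p \le \sigma(m)+1$, so the count is a Legendre sieve with error at most
  $2^{\pi(\sigma(m)+1)}$. That $\pi(\sigma(m)+1) \le m + 7$ follows from the same sieve: write
  $m = 2^a r$ with $r$ odd and sift by the primes dividing $2r$. As
  $\sigma(r) \prod_{p \mid r} (1-1/p) \le r$, the main term is at most $m - r/2 + 1$, and the saving
  $r/2$ absorbs the sieve error $2^{\omega(r)+1}$ up to a constant.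
\<close>

section \<open>The sieve of Legendre\<close>

text \<open>The bound \<open>y\<close> is real because sifting by a further prime \<open>q\<close>
  passes from \<open>y\<close> to \<open>y / q\<close>.\<close>

definition sifted :: "nat set \<Rightarrow> real \<Rightarrow> nat set" where
  "sifted S y = {n. 0 < n \<and> real n \<le> y \<and> (\<forall>p\<in>S. \<not> p dvd n)}"

lemma finite_sifted [simp]: "finite (sifted S y)"
proof (rule finite_subset)
  show "sifted S y \<subseteq> {..nat \<lfloor>y\<rfloor>}"
    by (auto simp: sifted_def le_nat_floor)
qed simp

lemma card_sifted_empty:
  assumes "0 \<le> y"
  shows "card (sifted {} y) = nat \<lfloor>y\<rfloor>"
proof -
  have "sifted {} y = {1..nat \<lfloor>y\<rfloor>}"
    using assms by (auto simp: sifted_def le_nat_floor nat_le_iff le_floor_iff le_nat_iff)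
  thus ?thesis by simp
qed

text \<open>The numbers removed by \<open>q\<close> are the products \<open>q * k\<close> with
  \<open>k\<close> at most \<open>y / q\<close>. Since \<open>q\<close> differs from every prime in
  \<open>S\<close>, such a product survives sifting by \<open>S\<close> exactly when
  \<open>k\<close> does.\<close>

lemma card_sifted_insert:
  assumes q: "prime q" "q \<notin> S" and S: "\<And>p. p \<in> S \<Longrightarrow> prime p"
  shows "real (card (sifted (insert q S) y)) = card (sifted S y) - real (card (sifted S (y / q)))"
proof -
  have q0: "q > 0" using q prime_gt_0_nat by blast
  have dvd: "p dvd q * k \<longleftrightarrow> p dvd k" if "p \<in> S" for p k
    using that q S by (metis prime_dvd_mult_iff primes_dvd_imp_eq)
  have "sifted S y - sifted (insert q S) y = (*) q ` sifted S (y / q)" (is "?L = ?R")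
  proof
    show "?L \<subseteq> ?R"
    proof
      fix n assume n: "n \<in> ?L"
      then obtain k where k: "n = q * k" by (auto simp: sifted_def)
      have "k \<in> sifted S (y / q)"
        using n k q0 dvd by (auto simp: sifted_def field_simps)
      thus "n \<in> ?R" using k by blast
    qed
    show "?R \<subseteq> ?L"
      using q0 dvd by (auto simp: sifted_def field_simps)
  qed
  moreover have "card ((*) q ` sifted S (y / q)) = card (sifted S (y / q))"
    using q0 by (intro card_image) (auto simp: inj_on_def)
  moreover have sub: "sifted (insert q S) y \<subseteq> sifted S y"
    by (auto simp: sifted_def)
  ultimately have "card (sifted S (y / q)) = card (sifted S y) - card (sifted (insert q S) y)"
    by (metis card_Diff_subset finite_sifted)
  \<comment> \<open>The difference just obtained is truncated subtraction on naturals; monotonicity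
    lets it pass to the reals.\<close>
  moreover have "card (sifted (insert q S) y) \<le> card (sifted S y)"
    using sub by (simp add: card_mono)
  ultimately show ?thesis by simp
qed

text \<open>With no primes the error is the fractional part of \<open>y\<close>. Each further prime
  combines the errors at \<open>y\<close> and at \<open>y / q\<close>, so the bound doubles; hence
  the induction generalizes over \<open>y\<close>.\<close>

lemma legendre_sieve:
  assumes "finite S" "\<And>p. p \<in> S \<Longrightarrow> prime p" "0 \<le> y"
  shows "\<bar>real (card (sifted S y)) - y * (\<Prod>p\<in>S. 1 - 1 / real p)\<bar> \<le> 2 ^ card S"
  using assms
proof (induction S arbitrary: y rule: finite_induct)
  case empty
  thus ?case by (simp add: card_sifted_empty) linarith
next
  case (insert q S)
  let ?P = "\<Prod>p\<in>S. 1 - 1 / real p"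
  have "\<bar>real (card (sifted S y)) - y * ?P\<bar> \<le> 2 ^ card S"
    and "\<bar>real (card (sifted S (y / q))) - y / q * ?P\<bar> \<le> 2 ^ card S"
    using insert.prems by (intro insert.IH; simp)+
  moreover have "y * ((1 - 1 / real q) * ?P) = y * ?P - y / q * ?P"
    by (simp add: algebra_simps)
  moreover have "real (card (sifted (insert q S) y))
      = card (sifted S y) - real (card (sifted S (y / q)))"
    using insert by (intro card_sifted_insert) auto
  moreover have "y * (\<Prod>p\<in>insert q S. 1 - 1 / real p) = y * ((1 - 1 / real q) * ?P)"
    and "(2::real) ^ card (insert q S) = 2 * 2 ^ card S"
    using insert.hyps by simp_all
  ultimately show ?case by linarith
qed

text \<open>A prime outside \<open>S\<close> is divisible by no prime of \<open>S\<close>, so it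
  survives the sieve.\<close>

lemma card_primes_le_sifted:
  assumes "finite S" "\<And>p. p \<in> S \<Longrightarrow> prime p"
  shows "card {p. prime p \<and> p \<le> N} \<le> card S + card (sifted S (real N))"
proof -
  have "{p. prime p \<and> p \<le> N} \<subseteq> S \<union> sifted S (real N)"
    using assms(2) by (auto simp: sifted_def prime_gt_0_nat dest: primes_dvd_imp_eq)
  hence "card {p. prime p \<and> p \<le> N} \<le> card (S \<union> sifted S (real N))"
    using assms by (intro card_mono) auto
  also have "\<dots> \<le> card S + card (sifted S (real N))" by (rule card_Un_le)
  finally show ?thesis .
qed

section \<open>The number of primes up to $\sigma(m)+1$\<close>

text \<open>Each divisor of the product has the form \<open>q ^ i * e\<close> with \<open>i\<close>
  at most \<open>a\<close> and \<open>e\<close> dividing \<open>r\<close>. Several pairs may give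
  the same divisor, hence an inequality.\<close>

lemma divisor_sum_prime_power_mult_le:
  assumes "prime q" "r > 0"
  shows "divisor_sum (q ^ a * r) \<le> (\<Sum>i\<le>a. q ^ i) * divisor_sum r"
proof -
  let ?f = "\<lambda>(i, e). q ^ i * e"
  have "{d. d dvd q ^ a * r} \<subseteq> ?f ` ({..a} \<times> {e. e dvd r})"
  proof
    fix d assume "d \<in> {d. d dvd q ^ a * r}"
    then obtain b e where d: "d = b * e" "b dvd q ^ a" "e dvd r"
      using division_decomp[of d "q ^ a" r] by auto
    then obtain i where "i \<le> a" "b = q ^ i"
      using assms divides_primepow_nat by blast
    thus "d \<in> ?f ` ({..a} \<times> {e. e dvd r})" using d by force
  qed
  hence "divisor_sum (q ^ a * r) \<le> \<Sum>(?f ` ({..a} \<times> {e. e dvd r}))"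
    unfolding divisor_sum_def using assms by (intro sum_mono2) auto
  also have "\<dots> \<le> (\<Sum>x\<in>{..a} \<times> {e. e dvd r}. ?f x)"
    using sum_image_le[of "{..a} \<times> {e. e dvd r}" "\<lambda>x. x" ?f] assms by simp
  also have "\<dots> = (\<Sum>i\<le>a. q ^ i) * divisor_sum r"
    by (simp add: divisor_sum_def sum_product sum.cartesian_product)
  finally show ?thesis .
qed

lemma geometric_sum_mult:
  assumes "q > (0::nat)"
  shows "real (\<Sum>i\<le>a. q ^ i) * (1 - 1 / real q) = real q ^ a - 1 / real q"
proof (induction a)
  case (Suc a)
  thus ?case using assms by (simp add: distrib_right) (simp add: field_simps)
qed simp

lemma prod_one_minus_inverse_bounds:
  assumes "\<And>p. p \<in> S \<Longrightarrow> prime p"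
  shows "0 \<le> (\<Prod>p\<in>S. 1 - 1 / real p)" "(\<Prod>p\<in>S. 1 - 1 / real p) \<le> 1"
proof -
  have "0 \<le> 1 - 1 / real p" "1 - 1 / real p \<le> 1" if "p \<in> S" for p
    using assms[OF that] prime_ge_1_nat[of p] by (auto simp: field_simps)
  thus "0 \<le> (\<Prod>p\<in>S. 1 - 1 / real p)" "(\<Prod>p\<in>S. 1 - 1 / real p) \<le> 1"
    by (auto intro!: prod_nonneg prod_le_1)
qed

text \<open>Multiplying by \<open>1 - 1 / q\<close> turns the divisor sum of \<open>q ^ a\<close>
  into \<open>q ^ a - 1 / q\<close>, which is at most \<open>q ^ a\<close>. The induction strips one
  full prime power at a time; exponent 0 covers the primes of \<open>S\<close> that do not divide
  \<open>n\<close>.\<close>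

lemma divisor_sum_mult_prod_le:
  assumes "finite S" "\<And>p. p \<in> S \<Longrightarrow> prime p" "n > 0" "prime_factors n \<subseteq> S"
  shows "real (divisor_sum n) * (\<Prod>p\<in>S. 1 - 1 / real p) \<le> real n"
  using assms
proof (induction S arbitrary: n rule: finite_induct)
  case empty
  hence "n = 1"
    by (metis One_nat_def bot.extremum_uniqueI empty_iff in_prime_factors_iff
        nat_neq_iff prime_factor_nat less_one)
  thus ?case by (simp add: divisor_sum_def)
next
  case (insert q S)
  let ?P = "\<Prod>p\<in>S. 1 - 1 / real p"
  have q: "prime q" "q > 0" using insert by (auto simp: prime_gt_0_nat)
  obtain r where r: "n = q ^ multiplicity q n * r" "\<not> q dvd r"
    using multiplicity_decompose'[of n q] insert q by (metis not_prime_unit not_gr_zero)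
  define a where "a = multiplicity q n"
  have n: "n = q ^ a * r" using r a_def by simp
  have r0: "r > 0" using n insert by (cases r) auto
  have "prime_factors r \<subseteq> prime_factors n"
    using n insert by (intro dvd_prime_factors) auto
  hence "prime_factors r \<subseteq> S" using insert r by (auto simp: in_prime_factors_iff)
  hence IH: "real (divisor_sum r) * ?P \<le> real r"
    using insert r0 by (intro insert.IH) auto
  have P: "?P \<ge> 0" "1 - 1 / real q \<ge> 0"
    using prod_one_minus_inverse_bounds(1)[of S] prod_one_minus_inverse_bounds(1)[of "{q}"] insert q
    by auto
  have "real (divisor_sum n) * ((1 - 1 / real q) * ?P)
      \<le> real ((\<Sum>i\<le>a. q ^ i) * divisor_sum r) * ((1 - 1 / real q) * ?P)"
    unfolding n using q r0 P
    by (intro mult_right_mono of_nat_mono divisor_sum_prime_power_mult_le) auto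
  also have "\<dots> = (real (\<Sum>i\<le>a. q ^ i) * (1 - 1 / real q)) * (real (divisor_sum r) * ?P)"
    by (simp only: of_nat_mult mult_ac)
  also have "\<dots> = (real q ^ a - 1 / real q) * (real (divisor_sum r) * ?P)"
    by (simp only: geometric_sum_mult[OF q(2)])
  also have "\<dots> \<le> real q ^ a * real r"
    using IH P q by (intro mult_mono) auto
  finally show ?case using insert n by simp
qed

text \<open>Only 3 is an odd prime below 4, and it occurs at most once, so it costs a single factor
  3/4.\<close>

lemma four_power_le_prod_odd_primes:
  assumes "finite A" "\<And>p. p \<in> A \<Longrightarrow> prime p \<and> odd p"
  shows "3 * 4 ^ card A \<le> 4 * (\<Prod>A :: nat)"
proof -
  have "4 \<le> p" if "p \<in> A - {3}" for p
  proof -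
    have "p \<ge> 2" "p \<noteq> 2" "p \<noteq> 3" using that assms(2)[of p] prime_ge_2_nat[of p] by auto
    thus ?thesis by linarith
  qed
  hence "(\<Prod>p\<in>A - {3}. 4) \<le> (\<Prod>(A - {3}))"
    by (intro prod_mono) auto
  hence *: "4 ^ card (A - {3}) \<le> \<Prod>(A - {3})" by simp
  show ?thesis
  proof (cases "3 \<in> A")
    case True
    hence "card A = Suc (card (A - {3}))" "\<Prod>A = 3 * \<Prod>(A - {3})"
      using assms by (simp_all add: prod.remove card_Suc_Diff1 del: card_Diff_insert)
    thus ?thesis using * by simp
  next
    case False
    thus ?thesis using * by simp
  qed
qed

lemma prod_prime_factors_le:
  assumes "n > (0::nat)"
  shows "\<Prod>(prime_factors n) \<le> n"
proof -
  have "\<Prod>(prime_factors n) \<le> (\<Prod>p\<in>prime_factors n. p ^ multiplicity p n)"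
    using assms by (intro prod_mono)
      (auto simp: prime_factors_multiplicity prime_gt_0_nat intro!: self_le_power Suc_leI)
  also have "\<dots> = n" using assms by (metis prime_factorization_nat)
  finally show ?thesis .
qed

text \<open>Put u = 2^w, where w is the number of prime factors. The product of these primes is at
  most \<open>r\<close>, so 3 u^2 \<le> 4 r. The tangent bound u^2 \<ge> 8 u - 16 at u = 4 makes
  this linear in u.\<close>

lemma six_two_power_omega_le:
  assumes "odd (r::nat)"
  shows "6 * 2 ^ card (prime_factors r) \<le> real r + 12"
proof -
  let ?w = "card (prime_factors r)"
  have "3 * 4 ^ ?w \<le> 4 * \<Prod>(prime_factors r)"
    using assms by (intro four_power_le_prod_odd_primes) (auto intro: dvd_trans)
  also have "\<dots> \<le> 4 * r"
    using assms by (intro mult_left_mono prod_prime_factors_le) (auto simp: odd_pos)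
  finally have "real (3 * 4 ^ ?w) \<le> real (4 * r)" by (rule of_nat_mono)
  moreover have "(4::real) ^ ?w = (2 ^ ?w)\<^sup>2" by (simp add: power2_eq_square flip: power_mult_distrib)
  moreover have "0 \<le> ((2::real) ^ ?w - 4)\<^sup>2" by simp
  ultimately show ?thesis by (simp add: power2_diff)
qed

lemma card_primes_divisor_sum_le:
  assumes "m > 0"
  shows "card {p. prime p \<and> p \<le> divisor_sum m + 1} \<le> m + 7"
proof -
  obtain r where "m = 2 ^ multiplicity 2 m * r" "odd r"
    using multiplicity_decompose'[of m 2] assms by auto
  then obtain a where m: "m = 2 ^ a * r" and r: "odd r" by blast
  have r0: "r > 0" using r by (rule odd_pos)
  define w where "w = card (prime_factors r)"
  define Q where "Q = (\<Prod>p\<in>prime_factors r. 1 - 1 / real p)"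
  define S where "S = insert 2 (prime_factors r)"
  have S: "finite S" "\<And>p. p \<in> S \<Longrightarrow> prime p" by (auto simp: S_def)
  have "2 \<notin> prime_factors r" using r by auto
  hence card_S: "card S = w + 1" and prod_S: "(\<Prod>p\<in>S. 1 - 1 / real p) = Q / 2"
    by (simp_all add: S_def w_def Q_def)
  have Q: "0 \<le> Q" "Q \<le> 1"
    unfolding Q_def by (intro prod_one_minus_inverse_bounds; auto)+
  have IH: "real (divisor_sum r) * Q \<le> real r"
    unfolding Q_def using r0 by (intro divisor_sum_mult_prod_le) auto
  \<comment> \<open>The power of 2 is evaluated exactly: its defect 1/2, multiplied by
    \<open>r\<close>, is the saving \<open>r / 2\<close>.\<close>
  have "real (divisor_sum m) * (Q / 2) \<le> real ((\<Sum>i\<le>a. 2 ^ i) * divisor_sum r) * (Q / 2)"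
    unfolding m using r0 Q
    by (intro mult_right_mono of_nat_mono divisor_sum_prime_power_mult_le) auto
  also have "\<dots> = (real (\<Sum>i\<le>a. 2 ^ i) * (1 - 1 / real 2)) * (real (divisor_sum r) * Q)"
    by (simp del: of_nat_sum)
  also have "\<dots> = (2 ^ a - 1 / 2) * (real (divisor_sum r) * Q)"
    using geometric_sum_mult[of 2 a] by simp
  also have "\<dots> \<le> (2 ^ a - 1 / 2) * real r"
    using IH one_le_power[of "2::real" a] by (intro mult_left_mono) linarith+
  also have "\<dots> = real m - real r / 2" by (simp add: m algebra_simps)
  finally have main: "real (divisor_sum m) * (Q / 2) \<le> real m - real r / 2" .
  have "\<bar>real (card (sifted S (real (divisor_sum m + 1))))
      - real (divisor_sum m + 1) * (Q / 2)\<bar> \<le> 2 ^ (w + 1)"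
    using legendre_sieve[OF S, of "real (divisor_sum m + 1)"] by (simp add: prod_S card_S)
  hence "real (card (sifted S (real (divisor_sum m + 1)))) \<le> real m - real r / 2 + 1 + 2 * 2 ^ w"
    using main Q by (simp add: distrib_right add_divide_distrib)
  moreover have "real (w + 1) \<le> 2 ^ w"
    using of_nat_mono[OF Suc_leI[OF less_exp[of w]], where 'a = real] by simp
  moreover have "6 * 2 ^ w \<le> real r + 12"
    unfolding w_def using r by (rule six_two_power_omega_le)
  moreover have "real (card {p. prime p \<and> p \<le> divisor_sum m + 1})
      \<le> real (w + 1) + real (card (sifted S (real (divisor_sum m + 1))))"
    using card_primes_le_sifted[OF S, of "divisor_sum m + 1"] card_S by simp
  \<comment> \<open>The bounds add up to (w + 1) + (m - r/2 + 1 + 2 * 2^w). Replacing w + 1 by 2^w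
    leaves m + 1 + 3 * 2^w - r/2, and 3 * 2^w - r/2 is at most 6, which gives the constant
    7.\<close>
  ultimately have "real (card {p. prime p \<and> p \<le> divisor_sum m + 1}) \<le> real (m + 7)"
    unfolding of_nat_add of_nat_1 of_nat_numeral by linarith
  thus ?thesis by linarith
qed

section \<open>Practical numbers and the practical component\<close>

text \<open>Let \<open>e\<close> be the least divisor of \<open>m\<close> that is at least
  \<open>t\<close>. Practicality writes \<open>e - 1\<close> as a sum of distinct divisors; these
  are below \<open>e\<close>, hence below \<open>t\<close> by minimality. If no divisor reaches
  \<open>t\<close>, the sum is the whole of \<open>divisor_sum m\<close>.\<close>

lemma practical_gap:
  assumes "practical m" "t \<le> divisor_sum m + 1"
  shows "t \<le> \<Sum>{d. d dvd m \<and> d < t} + 1"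
proof (cases "\<exists>d. d dvd m \<and> t \<le> d \<and> t > 0")
  case True
  define e where "e = (LEAST d. d dvd m \<and> t \<le> d)"
  have e: "e dvd m" "t \<le> e" using LeastI_ex[of "\<lambda>d. d dvd m \<and> t \<le> d"] True by (auto simp: e_def)
  have least: "d < t" if "d dvd m" "d < e" for d
    using that not_less_Least[of d "\<lambda>d. d dvd m \<and> t \<le> d"] by (auto simp: e_def)
  have m: "m > 0" using assms by (simp add: practical_def)
  show ?thesis
  \<comment> \<open>For \<open>t = 1\<close> also \<open>e = 1\<close>, and \<open>e - 1 = 0\<close>
    lies outside the range \<open>{1..m}\<close> of the definition; the bound is then
    trivial.\<close>
  proof (cases "t = 1")
    case False
    hence "e - 1 \<in> {1..m}" using e m True dvd_imp_le[of e m] by auto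
    then obtain D where D: "D \<subseteq> {d. d dvd m}" "e - 1 = \<Sum>D"
      using assms(1) unfolding practical_def by blast
    have finD: "finite D" using m by (intro finite_subset[OF D(1)]) simp
    have "d < t" if "d \<in> D" for d
    proof -
      have "d \<le> \<Sum>D" using that finD member_le_sum[of d D "\<lambda>x. x"] by simp
      hence "d < e" using D(2) e True by linarith
      thus ?thesis using that D least by blast
    qed
    hence "\<Sum>D \<le> \<Sum>{d. d dvd m \<and> d < t}"
      using D m by (intro sum_mono2) auto
    thus ?thesis using D e by linarith
  qed simp
next
  case False
  hence "{d. d dvd m \<and> d < t} = {d. d dvd m}" if "t > 0" using that by force
  thus ?thesis using assms by (cases "t = 0") (auto simp: divisor_sum_def)
qed

text \<open>The largest element \<open>b\<close> is added last. A target up to the sum of the others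
  needs no \<open>b\<close>; a larger target uses \<open>b\<close>, and the remainder falls to the
  induction hypothesis.\<close>

lemma subset_sums_if_no_gaps:
  fixes A :: "nat set"
  assumes "finite A" "\<And>d. d \<in> A \<Longrightarrow> d \<le> \<Sum>{e \<in> A. e < d} + 1" "k \<le> \<Sum>A"
  shows "\<exists>D. D \<subseteq> A \<and> k = \<Sum>D"
  using assms
proof (induction A arbitrary: k rule: finite_linorder_max_induct)
  case (insert b A)
  have b: "b \<notin> A" using insert by auto
  have no_gaps: "d \<le> \<Sum>{e \<in> A. e < d} + 1" if "d \<in> A" for d
  proof -
    have "{e \<in> insert b A. e < d} = {e \<in> A. e < d}"
      using insert(2) that by force
    thus ?thesis using insert.prems(1)[of d] that by auto
  qed
  have "{e \<in> insert b A. e < b} = A" using insert(2) by auto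
  hence b_le: "b \<le> \<Sum>A + 1" using insert.prems(1)[of b] by simp
  show ?case
  proof (cases "k \<le> \<Sum>A")
    case True
    then obtain D where "D \<subseteq> A" "k = \<Sum>D" using insert.IH[OF no_gaps] by blast
    thus ?thesis by blast
  next
    case False
    \<comment> \<open>The subtraction is exact: \<open>k\<close> exceeds the sum of
      \<open>A\<close>, and \<open>b\<close> exceeds that sum by at most 1.\<close>
    have "k - b \<le> \<Sum>A" using insert.prems insert.hyps b by simp
    then obtain D where D: "D \<subseteq> A" "k - b = \<Sum>D" using insert.IH[OF no_gaps] by blast
    have "finite D" "b \<notin> D" using D b insert.hyps by (auto intro: finite_subset)
    hence "k = \<Sum>(insert b D)" using D False b_le by simp
    thus ?thesis using D by blast
  qed
qed simp

lemma practicalI_no_gaps: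
  assumes "n > 0" "\<And>d. d dvd n \<Longrightarrow> d \<le> \<Sum>{e. e dvd n \<and> e < d} + 1"
  shows "practical n"
  unfolding practical_def
proof (intro conjI ballI)
  fix k assume "k \<in> {1..n}"
  moreover have "n \<le> \<Sum>{d. d dvd n}" using assms by (intro member_le_sum) auto
  ultimately have "k \<le> \<Sum>{d. d dvd n}" by simp
  thus "\<exists>D. D \<subseteq> {d. d dvd n} \<and> k = \<Sum>D"
    using assms by (intro subset_sums_if_no_gaps) auto
qed (use assms in auto)

text \<open>A divisor of \<open>m * p\<close> is \<open>e\<close> or \<open>p * e\<close> with
  \<open>e\<close> dividing \<open>m\<close>. In the first case the gap bound comes from
  \<open>m\<close> alone. For \<open>p * e\<close>, the multiples of \<open>p\<close> from the
  divisors of \<open>m\<close> below \<open>e\<close> sum to at least \<open>p * e - p\<close>, and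
  the divisors of \<open>m\<close> below \<open>p\<close> supply another \<open>p - 1\<close>; this
  last bound uses the assumption on the size of \<open>p\<close>.\<close>

lemma practical_mult_prime:
  assumes m: "practical m" and p: "prime p" "p \<le> divisor_sum m + 1"
  shows "practical (m * p)"
proof (rule practicalI_no_gaps)
  have m0: "m > 0" using m by (simp add: practical_def)
  have p0: "p > 0" using p by (simp add: prime_gt_0_nat)
  show "m * p > 0" using m0 p0 by simp
  fix d assume "d dvd m * p"
  then obtain e f where ef: "d = e * f" "e dvd m" "f dvd p" using division_decomp by blast
  hence f: "f = 1 \<or> f = p" using p by (auto simp: prime_nat_iff)
  have div_le: "t \<le> divisor_sum m + 1" if "t dvd m" for t
    using that m0 member_le_sum[of t "{d. d dvd m}" "\<lambda>x. x"] by (simp add: divisor_sum_def)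
  show "d \<le> \<Sum>{e. e dvd m * p \<and> e < d} + 1"
  proof (cases "f = 1")
    case True
    have "d \<le> \<Sum>{e. e dvd m \<and> e < d} + 1" using True ef div_le m by (intro practical_gap) auto
    also have "\<dots> \<le> \<Sum>{e. e dvd m * p \<and> e < d} + 1"
      using m0 p0 by (intro add_right_mono sum_mono2) auto
    finally show ?thesis .
  next
    case False
    hence d: "d = p * e" using f ef by simp
    have e0: "e > 0" using ef m0 by (auto intro: Nat.gr0I)
    define A where "A = {f. f dvd m \<and> f < e}"
    define B where "B = {f. f dvd m \<and> f < p}"
    have fin: "finite A" "finite B" using m0 by (auto simp: A_def B_def)
    text \<open>The elements of \<open>B\<close> lie below \<open>p\<close>, so they are not multiples of \<open>p\<close>,
      even if \<open>p\<close> divides \<open>m\<close>.\<close>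
    have disj: "(*) p ` A \<inter> B = {}"
      using m0 by (auto simp: A_def B_def)
    have "e \<le> \<Sum>A + 1" unfolding A_def using ef div_le m by (intro practical_gap) auto
    hence "p * e \<le> p * (\<Sum>A + 1)" by (rule mult_left_mono) simp
    moreover have "p \<le> \<Sum>B + 1" unfolding B_def using m p by (intro practical_gap) auto
    ultimately have "d \<le> p * \<Sum>A + \<Sum>B + 1" using d by (simp add: algebra_simps)
    also have "p * \<Sum>A = \<Sum>((*) p ` A)"
      using p0 by (subst sum.reindex) (auto simp: inj_on_def sum_distrib_left)
    also have "\<Sum>((*) p ` A) + \<Sum>B = \<Sum>((*) p ` A \<union> B)"
      using fin disj by (simp add: sum.union_disjoint)
    also have "\<dots> \<le> \<Sum>{e. e dvd m * p \<and> e < d}"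
    proof (intro sum_mono2)
      have "p \<le> p * e" using e0 by simp
      thus "(*) p ` A \<union> B \<subseteq> {e. e dvd m * p \<and> e < d}"
        using p0 e0 by (auto simp: A_def B_def d mult.commute[of m] intro: less_le_trans)
    qed (use m0 p0 in auto)
    finally show ?thesis by simp
  qed
qed

lemma practical_1: "practical 1"
  by (rule practicalI_no_gaps) auto

text \<open>If a small prime \<open>p\<close> divided the cofactor \<open>k\<close>, then
  \<open>m * p\<close> would be a larger practical divisor. Conversely, if \<open>k\<close> has no
  small prime factor, a practical divisor beyond \<open>m\<close> could not represent
  \<open>divisor_sum m + 1\<close>.\<close>

lemma practical_component_eq_iff:
  assumes n: "n > 0"
  shows "practical_component n = m \<longleftrightarrow>
    practical m \<and> (\<exists>k. n = m * k \<and> (\<forall>p. prime p \<and> p \<le> divisor_sum m + 1 \<longrightarrow> \<not> p dvd k))"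
    (is "?L \<longleftrightarrow> ?R")
proof -
  let ?D = "{d. d dvd n \<and> practical d}"
  have fin: "finite ?D" using n by simp
  have "1 \<in> ?D" using practical_1 by simp
  hence ne: "?D \<noteq> {}" by blast
  show ?thesis
  proof
    assume L: ?L
    hence "m \<in> ?D" using Max_in[OF fin ne] by (simp add: practical_component_def)
    then obtain k where m: "practical m" "n = m * k" by auto
    have "\<not> p dvd k" if p: "prime p" "p \<le> divisor_sum m + 1" for p
    proof
      assume "p dvd k"
      hence "m * p \<in> ?D" using m p practical_mult_prime by (auto intro: mult_dvd_mono)
      hence "m * p \<le> m" using L Max_ge[OF fin] by (auto simp: practical_component_def)
      moreover have "m > 0" "p > 1" using m(1) p(1) prime_gt_1_nat by (auto simp: practical_def)
      ultimately show False by simp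
    qed
    thus ?R using m by blast
  next
    assume ?R
    then obtain k where m: "practical m" and k: "n = m * k"
      and sift: "\<And>p. prime p \<Longrightarrow> p \<le> divisor_sum m + 1 \<Longrightarrow> \<not> p dvd k" by blast
    have m0: "m > 0" using m by (simp add: practical_def)
    \<comment> \<open>A prime dividing both \<open>f\<close> and \<open>k\<close> would be at most
      \<open>f\<close>, hence within the sifting range.\<close>
    have small: "f dvd m" if f: "f dvd n" "f \<le> divisor_sum m + 1" for f
    proof -
      have f0: "f > 0" using f n by (auto intro: Nat.gr0I)
      have "coprime f k"
      proof (rule ccontr)
        assume "\<not> coprime f k"
        hence "gcd f k \<noteq> 1" by (simp add: coprime_iff_gcd_eq_1)
        then obtain p where "prime p" "p dvd f" "p dvd k"
          using prime_factor_nat by (metis gcd_greatest_iff)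
        thus False using sift f f0 by (meson dvd_imp_le le_trans)
      qed
      thus ?thesis using f k by (simp add: coprime_dvd_mult_left_iff)
    qed
    have "d \<le> m" if d: "d dvd n" "practical d" for d
    proof (rule ccontr)
      assume "\<not> d \<le> m"
      hence "\<not> d dvd m" using m0 dvd_imp_le by blast
      \<comment> \<open>By \<open>small\<close>, a divisor of \<open>n\<close> not dividing
        \<open>m\<close> exceeds \<open>divisor_sum m + 1\<close>. So this number must be a sum of
        distinct divisors of \<open>d\<close>; none of them exceeds it, so all divide
        \<open>m\<close>, and their total is too small by 1.\<close>
      hence "divisor_sum m + 1 \<in> {1..d}" using small d by force
      then obtain D where D: "D \<subseteq> {e. e dvd d}" "divisor_sum m + 1 = \<Sum>D"
        using d(2) unfolding practical_def by blast
      have "finite D" using d by (intro finite_subset[OF D(1)]) (simp add: practical_def)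
      hence "e \<le> \<Sum>D" if "e \<in> D" for e
        using that member_le_sum[of e D "\<lambda>x. x"] by simp
      hence "D \<subseteq> {e. e dvd m}"
        using D small dvd_trans[OF _ d(1)] by (simp add: subset_iff)
      hence "\<Sum>D \<le> divisor_sum m" unfolding divisor_sum_def using m0 by (intro sum_mono2) auto
      thus False using D by simp
    qed
    hence "Max ?D = m" using fin m k by (intro Max_eqI) auto
    thus ?L by (simp add: practical_component_def)
  qed
qed

section \<open>Fibres of the practical component and jumps of mu\<close>

lemma card_practical_component_eq:
  assumes "practical m"
  shows "card {n. n \<ge> 1 \<and> real n \<le> x \<and> practical_component n = m}
    = card (sifted {p. prime p \<and> p \<le> divisor_sum m + 1} (x / m))"
proof -
  have m0: "m > 0" using assms by (simp add: practical_def)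
  have "{n. n \<ge> 1 \<and> real n \<le> x \<and> practical_component n = m}
      = (*) m ` sifted {p. prime p \<and> p \<le> divisor_sum m + 1} (x / m)" (is "?L = ?R")
  proof (intro set_eqI)
    fix n
    have "n \<in> ?L \<longleftrightarrow> n > 0 \<and> real n \<le> x \<and>
        (\<exists>k. n = m * k \<and> (\<forall>p. prime p \<and> p \<le> divisor_sum m + 1 \<longrightarrow> \<not> p dvd k))"
      using assms practical_component_eq_iff[of n m] by (auto simp: Suc_le_eq)
    also have "\<dots> \<longleftrightarrow> n \<in> ?R"
      using m0 by (auto simp: sifted_def field_simps image_iff)
    finally show "n \<in> ?L \<longleftrightarrow> n \<in> ?R" .
  qed
  thus ?thesis using m0 by (simp add: card_image inj_on_def)
qed

text \<open>\<open>practical_mu\<close> is a step function, constant just to the right of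
  \<open>m\<close>. Its sum runs over \<open>n < y\<close> strictly, so the term at \<open>m\<close>
  is absent at \<open>m\<close> itself and present in the right-hand limit; the jump is that
  term.\<close>

lemma practical_alpha_eq:
  assumes "m \<ge> 1"
  shows "practical_alpha m =
    practical_chi m / real m * (\<Prod>p | prime p \<and> p \<le> divisor_sum m + 1. 1 - 1 / real p)"
proof -
  define f where "f n = practical_chi n / real n *
    (\<Prod>p | prime p \<and> p \<le> divisor_sum n + 1. 1 - 1 / real p)" for n
  have mu: "practical_mu y = 1 - (\<Sum>n | n > 0 \<and> real n < y. f n)" for y
    by (simp add: practical_mu_def f_def)
  have "practical_mu y = 1 - (\<Sum>n\<in>{1..m}. f n)" if "y \<in> {real m<..<real m + 1}" for y
  proof -
    have "{n. n > 0 \<and> real n < y} = {1..m}" using that by auto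
    thus ?thesis by (simp add: mu)
  qed
  hence "\<forall>\<^sub>F y in at_right (real m). practical_mu y = 1 - (\<Sum>n\<in>{1..m}. f n)"
    using eventually_at_right_real[of "real m" "real m + 1"] by (auto elim: eventually_mono)
  hence "(practical_mu \<longlongrightarrow> 1 - (\<Sum>n\<in>{1..m}. f n)) (at_right (real m))"
    by (rule tendsto_eventually)
  hence "Lim (at_right (real m)) practical_mu = 1 - (\<Sum>n\<in>{1..m}. f n)"
    by (intro tendsto_Lim) auto
  moreover have "{n. n > 0 \<and> real n < real m} = {1..<m}" by auto
  moreover have "{1..m} = insert m {1..<m}" using assms by auto
  ultimately show ?thesis by (simp add: practical_alpha_def mu f_def)
qed

theorem corollary1:
  "(\<forall>m::nat. m \<ge> 1 \<longrightarrow>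
      practical_alpha m =
        practical_chi m / real m * (\<Prod>p | prime p \<and> p \<le> divisor_sum m + 1. 1 - 1 / real p)) \<and>
   (\<exists>C::real. \<forall>x::real. \<forall>m::nat. x \<ge> 1 \<longrightarrow> m \<ge> 1 \<longrightarrow>
      \<bar>real (card {n::nat. n \<ge> 1 \<and> real n \<le> x \<and> practical_component n = m})
         - x * practical_alpha m\<bar> \<le> C * 2 ^ m)"
proof (intro conjI allI impI exI)
  fix x :: real and m :: nat
  assume x: "x \<ge> 1" and m: "m \<ge> 1"
  let ?S = "{p. prime p \<and> p \<le> divisor_sum m + 1}"
  \<comment> \<open>The absolute constant is chosen here: \<open>2 ^ 7\<close> comes from the bound
    \<open>m + 7\<close> on the number of sifting primes.\<close>
  show "\<bar>real (card {n::nat. n \<ge> 1 \<and> real n \<le> x \<and> practical_component n = m})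
         - x * practical_alpha m\<bar> \<le> 2 ^ 7 * 2 ^ m"
  proof (cases "practical m")
    case True
    have "\<bar>real (card (sifted ?S (x / m))) - x / m * (\<Prod>p\<in>?S. 1 - 1 / real p)\<bar> \<le> 2 ^ card ?S"
      using x by (intro legendre_sieve) auto
    also have "\<dots> \<le> 2 ^ (m + 7)"
      using card_primes_divisor_sum_le[of m] m by (intro power_increasing) auto
    finally show ?thesis
      using True m card_practical_component_eq[OF True, of x]
      by (simp add: practical_alpha_eq practical_chi_def power_add mult.commute)
  next
    \<comment> \<open>A number that is not practical is no practical component, and
      \<open>practical_chi m = 0\<close>, so the count and the main term both vanish.\<close>
    case False
    hence empty: "{n::nat. n \<ge> 1 \<and> real n \<le> x \<and> practical_component n = m} = {}"
      using practical_component_eq_iff by auto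
    show ?thesis
      unfolding empty using False m by (simp add: practical_alpha_eq practical_chi_def)
  qed
qed (rule practical_alpha_eq)

end
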